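(* Let $D$ be a complete commutative normed ring of characteristic $0$ and let $A$ be an associative division Banach $D$-algebra. Then the map $x\mapsto x^{-1}$ is differentiable in the Gâteaux sense on the set of nonzero elements of $A$, and for every nonzero $x\in A$ $$\partial x^{-1}=-x^{-1}\otimes x^{-1},\qquad \partial x^{-1}\circ dx=-x^{-1}\,dx\,x^{-1}\quad(dx\in A).$$ Thus the components of the Gâteaux derivative are $$\frac{\partial_{1\cdot 0}x^{-1}}{\partial x}=-x^{-1},\qquad \frac{\partial_{1\cdot 1}x^{-1}}{\partial x}=x^{-1}.$$
   Context: A norm on a ring $D$ is a map $|\cdot|:D\to\mathbb R$ with $|a|\ge 0$; $|a|=0$ iff $a=0$; $|ab|=|a||b|$; $|a+b|\le|a|+|b|$. $D$ is complete if every Cauchy sequence converges. For a complete normed ring of characteristic $0$ the embedding of $\mathbb Q$ in $D$ is assumed to be a homeomorphism onto its image, and $D$ contains an isomorphic copy of $\mathbb R$. A $D$-algebra $A$ is a $D$-module with a $D$-bilinear product. A norm on $A$ satisfies $|a|\ge 0$; $|a|=0$ iff $a=0$; $|a+b|\le|a|+|b|$; $|ab|=|a||b|$; $|da|=|d||a|$ for $d\in D$. $A$ is a Banach $D$-algebra if it is complete for this norm. A division algebra is a unital algebra in which every nonzero element is invertible. A map $f$ into $A$ is differentiable in the Gâteaux sense on $U\subset A$ if for every $x\in U$ one has $f(x+a)-f(x)=\partial f(x)\circ a+o(a)$ (for increments $a$ for which the left side is defined), where $\partial f(x)$ is a $D$-linear map of $a$ and $o$ is a continuous map with $\lim_{a\to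 0}|o(a)|/|a|=0$. The paper uses interchangeably $\partial f(x)\circ a=\lim_{t\to 0,\,t\in\mathbb R}t^{-1}(f(x+ta)-f(x))$. Here $\circ$ denotes application of a linear map. A tensor $\sum_s p_s\otimes q_s\in A\otimes A$ is identified with the linear map $a\mapsto\sum_s p_s\,a\,q_s$. When $\partial f(x)=\sum_s p_s\otimes q_s$, the elements $p_s=\frac{\partial_{s\cdot 0}f(x)}{\partial x}$ and $q_s=\frac{\partial_{s\cdot 1}f(x)}{\partial x}$ are called components of the Gâteaux derivative. *)

theory Defs
  imports "HOL-Analysis.Analysis"
begin

text \<open>
  Unital rings with a multiplicative norm \<open>mnorm\<close>; metric and topology are the ones
  induced by it. The constant \<open>norm\<close> is not used, because the library's normed classes
  require a real scalar multiplication with \<open>norm (t *\<^sub>R x) = \<bar>t\<bar> * norm x\<close>,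
  whereas here the norm of the copy of a rational number \<open>t\<close> in the ring need not be
  \<open>\<bar>t\<bar>\<close> (for example, the square root of the usual absolute value is a norm on
  the reals).
\<close>

class mult_normed_ring = ring_1 + metric_space +
  fixes mnorm :: "'a \<Rightarrow> real"
  assumes mnorm_ge_0: "0 \<le> mnorm a"
    and mnorm_eq_0_iff: "mnorm a = 0 \<longleftrightarrow> a = 0"
    and mnorm_mult: "mnorm (a * b) = mnorm a * mnorm b"
    and mnorm_triangle: "mnorm (a + b) \<le> mnorm a + mnorm b"
    and dist_mnorm: "dist a b = mnorm (a - b)"

definition unital_ring_hom :: "('r::ring_1 \<Rightarrow> 's::ring_1) \<Rightarrow> bool" where
  "unital_ring_hom h \<longleftrightarrow>
     h 1 = 1 \<and> (\<forall>x y. h (x + y) = h x + h y) \<and> (\<forall>x y. h (x * y) = h x * h y)"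

text \<open>
  The type \<open>rat\<close> carries no topology in the library; its usual topology is
  the one pulled back from the reals. An \<open>embedding_map\<close> is a homeomorphism
  onto its image.
\<close>

definition rat_topology :: "rat topology" where
  "rat_topology = pullback_topology UNIV (of_rat :: rat \<Rightarrow> real) euclidean"

text \<open>
  \<open>real_emb\<close> identifies the reals, as a topological ring, with a subring of \<open>'d\<close>.
  It necessarily extends \<open>rat_emb\<close>, because a unital ring homomorphism on the
  rationals is unique.
\<close>

locale complete_normed_base_ring =
  fixes rat_emb :: "rat \<Rightarrow> 'd::{comm_ring_1, ring_char_0, mult_normed_ring, complete_space}"
    and real_emb :: "real \<Rightarrow> 'd"
  assumes rat_hom: "unital_ring_hom rat_emb"
    and rat_embedding: "embedding_map rat_topology euclidean rat_emb"
    and real_hom: "unital_ring_hom real_emb"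
    and real_embedding: "embedding_map euclidean euclidean real_emb"

text \<open>Associativity, the unit and the distributive laws come from the class \<open>ring_1\<close>.\<close>

locale banach_ring_algebra = module smul
  for smul :: "'d::{comm_ring_1, mult_normed_ring} \<Rightarrow> 'a::{mult_normed_ring, complete_space} \<Rightarrow> 'a" +
  assumes smul_mult_left: "smul d a * b = smul d (a * b)"
    and smul_mult_right: "a * smul d b = smul d (a * b)"
    and mnorm_smul: "mnorm (smul d a) = mnorm d * mnorm a"

text \<open>
  \<open>U\<close> is the domain of \<open>f\<close> (values of \<open>f\<close> outside \<open>U\<close> are irrelevant): the increments
  \<open>a\<close> are those with \<open>x + a \<in> U\<close>, and the remainder \<open>r\<close> is a continuous map on this
  set of increments.
\<close>

definition has_gateaux_derivative ::
  "('d::comm_ring_1 \<Rightarrow> 'a::mult_normed_ring \<Rightarrow> 'a) \<Rightarrow> ('a \<Rightarrow> 'a) \<Rightarrow> ('a \<Rightarrow> 'a) \<Rightarrow> 'a set \<Rightarrow> 'a \<Rightarrow> bool"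
  where
  "has_gateaux_derivative smul f L U x \<longleftrightarrow>
     module_hom smul smul L \<and>
     (\<exists>r. (\<forall>a. x + a \<in> U \<longrightarrow> f (x + a) - f x = L a + r a) \<and>
          continuous_on {a. x + a \<in> U} r \<and>
          ((\<lambda>a. mnorm (r a) / mnorm a) \<longlongrightarrow> 0) (at 0 within {a. x + a \<in> U}))"

definition gateaux_differentiable_on ::
  "('d::comm_ring_1 \<Rightarrow> 'a::mult_normed_ring \<Rightarrow> 'a) \<Rightarrow> ('a \<Rightarrow> 'a) \<Rightarrow> 'a set \<Rightarrow> bool"
  where
  "gateaux_differentiable_on smul f U \<longleftrightarrow>
     (\<forall>x\<in>U. \<exists>L. has_gateaux_derivative smul f L U x)"

definition gateaux_derivative ::
  "('d::comm_ring_1 \<Rightarrow> 'a::mult_normed_ring \<Rightarrow> 'a) \<Rightarrow> ('a \<Rightarrow> 'a) \<Rightarrow> 'a set \<Rightarrow> 'a \<Rightarrow> 'a \<Rightarrow> 'a"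
  where
  "gateaux_derivative smul f U x = (THE L. has_gateaux_derivative smul f L U x)"

text \<open>
  The linear map with which the tensor \<open>\<Sum>\<^sub>s p\<^sub>s \<otimes> q\<^sub>s\<close> is identified; the list holds
  the pairs \<open>(p\<^sub>s, q\<^sub>s)\<close>.
\<close>

definition tensor_map :: "('a::ring_1 \<times> 'a) list \<Rightarrow> 'a \<Rightarrow> 'a" where
  "tensor_map ts = (\<lambda>a. \<Sum>(p, q)\<leftarrow>ts. p * a * q)"

text \<open>
  Components of a derivative belong to a chosen representation as a tensor and are
  not unique, so they are a relation. The components with index \<open>s\<cdot>0\<close> and \<open>s\<cdot>1\<close>
  are the two entries of the \<open>s\<close>-th pair.
\<close>

definition gateaux_components ::
  "('d::comm_ring_1 \<Rightarrow> 'a::mult_normed_ring \<Rightarrow> 'a) \<Rightarrow> ('a \<Rightarrow> 'a) \<Rightarrow> 'a set \<Rightarrow> 'a \<Rightarrow> ('a \<times> 'a) list \<Rightarrow> bool"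
  where
  "gateaux_components smul f U x ts \<longleftrightarrow>
     (\<exists>L. has_gateaux_derivative smul f L U x) \<and>
     gateaux_derivative smul f U x = tensor_map ts"

end

theory Submission
  imports Defs
begin

text \<open>
  In a division ring \<open>y\<inverse> - x\<inverse> = - y\<inverse> (y - x) x\<inverse>\<close> for nonzero \<open>x\<close> and \<open>y\<close>. Applying this
  identity twice to \<open>y = x + a\<close> gives
  \<open>(x + a)\<inverse> - x\<inverse> = - x\<inverse> a x\<inverse> + (x + a)\<inverse> a x\<inverse> a x\<inverse>\<close>. By multiplicativity the last summand has
  norm \<open>|a|\<^sup>2 / (|x + a| |x|\<^sup>2)\<close>, which is \<open>o(a)\<close> because \<open>|x + a|\<close> tends to \<open>|x|\<close>. Hence
  \<open>a \<mapsto> - x\<inverse> a x\<inverse>\<close>, which is linear over the base ring, is a derivative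
  (\<open>has_gateaux_derivative_inverse\<close>).

  The derivative is determined by the map: if two linear maps differ by \<open>o(a)\<close>, then
  their difference \<open>M\<close> has \<open>|M (t b)| / |t b| = |M b| / |b|\<close> for every nonzero real \<open>t\<close>, since the
  norm of the base ring element \<open>t\<close> cancels, and letting \<open>t\<close> tend to \<open>0\<close> gives \<open>M b = 0\<close>
  (\<open>has_gateaux_derivative_unique\<close>). The norm of \<open>t\<close> in the base ring need not be its absolute
  value; what matters is that it is nonzero, because the reals are a field, and tends to
  \<open>0\<close> with \<open>t\<close>, because the reals are topologically embedded.

  The limit along a line comes from the first identity directly: the scalar \<open>t\<close> commutes
  with everything, so the difference quotient equals \<open>- (x + t b)\<inverse> b x\<inverse>\<close>, and the inverse is
  continuous.
\<close>

section \<open>Topology of a ring with a multiplicative norm\<close>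

lemma tendsto_iff_mnorm_diff:
  fixes f :: "'b \<Rightarrow> 'a::mult_normed_ring"
  shows "(f \<longlongrightarrow> l) F \<longleftrightarrow> ((\<lambda>x. mnorm (f x - l)) \<longlongrightarrow> 0) F"
  by (subst tendsto_dist_iff) (simp add: dist_mnorm)

lemma mnorm_zero [simp]: "mnorm (0 :: 'a::mult_normed_ring) = 0"
  by (simp add: mnorm_eq_0_iff)

lemma mnorm_one [simp]:
  assumes "(1 :: 'a::mult_normed_ring) \<noteq> 0"
  shows "mnorm (1 :: 'a) = 1"
  using assms mnorm_mult[of "1::'a" 1] mnorm_eq_0_iff[of "1::'a"] by simp

lemma mnorm_minus_commute: "mnorm (a - b) = mnorm (b - a :: 'a::mult_normed_ring)"
  by (metis dist_commute dist_mnorm)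

lemma mnorm_minus [simp]: "mnorm (- a :: 'a::mult_normed_ring) = mnorm a"
  using mnorm_minus_commute[of 0 a] by simp

lemma mnorm_triangle_diff: "mnorm (a - b :: 'a::mult_normed_ring) \<le> mnorm a + mnorm b"
  using mnorm_triangle[of a "- b"] by simp

lemma tendsto_mnorm [tendsto_intros]:
  fixes f :: "'b \<Rightarrow> 'a::mult_normed_ring"
  assumes "(f \<longlongrightarrow> l) F"
  shows "((\<lambda>x. mnorm (f x)) \<longlongrightarrow> mnorm l) F"
  using tendsto_dist[OF assms tendsto_const[of 0]] by (simp add: dist_mnorm)

text \<open>
  These two instances make the library's limit and continuity rules for sums,
  differences and products available.
\<close>

instance mult_normed_ring \<subseteq> topological_group_add
proof
  fix a b :: 'a
  let ?F = "nhds a \<times>\<^sub>F nhds b"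
  have "((\<lambda>x. mnorm (fst x - a) + mnorm (snd x - b)) \<longlongrightarrow> 0 + 0) ?F"
    by (intro tendsto_add tendsto_iff_mnorm_diff[THEN iffD1] filterlim_fst filterlim_snd)
  then have lim: "((\<lambda>x. mnorm (fst x - a) + mnorm (snd x - b)) \<longlongrightarrow> 0) ?F"
    by simp
  have bound: "mnorm (fst x + snd x - (a + b)) \<le> mnorm (fst x - a) + mnorm (snd x - b)" for x
    using mnorm_triangle[of "fst x - a" "snd x - b"] by (simp add: algebra_simps)
  show "((\<lambda>x. fst x + snd x) \<longlongrightarrow> a + b) ?F"
    unfolding tendsto_iff_mnorm_diff
    by (rule tendsto_sandwich[OF _ _ tendsto_const lim]) (auto simp: mnorm_ge_0 bound)
  show "(uminus \<longlongrightarrow> - a) (nhds a)"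
    using tendsto_iff_mnorm_diff[of "\<lambda>x. x" a "nhds a"] mnorm_minus_commute[of _ a]
    by (subst tendsto_iff_mnorm_diff) (simp add: filterlim_ident)
qed

instance mult_normed_ring \<subseteq> topological_semigroup_mult
proof
  fix a b :: 'a
  let ?F = "nhds a \<times>\<^sub>F nhds b"
  have "((\<lambda>x. mnorm (fst x - a) * mnorm (snd x) + mnorm a * mnorm (snd x - b)) 
      \<longlongrightarrow> 0 * mnorm b + mnorm a * 0) ?F"
    by (intro tendsto_add tendsto_mult tendsto_const tendsto_mnorm
        tendsto_iff_mnorm_diff[THEN iffD1] filterlim_fst filterlim_snd)
  then have lim: "((\<lambda>x. mnorm (fst x - a) * mnorm (snd x) + mnorm a * mnorm (snd x - b)) \<longlongrightarrow> 0) ?F"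
    by simp
  have bound: "mnorm (fst x * snd x - a * b)
      \<le> mnorm (fst x - a) * mnorm (snd x) + mnorm a * mnorm (snd x - b)" for x
  proof -
    have "fst x * snd x - a * b = (fst x - a) * snd x + a * (snd x - b)"
      by (simp add: algebra_simps)
    then show ?thesis
      by (metis mnorm_mult mnorm_triangle)
  qed
  show "((\<lambda>x. fst x * snd x) \<longlongrightarrow> a * b) ?F"
    unfolding tendsto_iff_mnorm_diff
    by (rule tendsto_sandwich[OF _ _ tendsto_const lim]) (auto simp: mnorm_ge_0 bound)
qed

section \<open>The inverse in a normed division ring\<close>

lemma inverse_diff_inverse_division_ring:
  fixes x y :: "'a::division_ring"
  assumes "x \<noteq> 0" "y \<noteq> 0"
  shows "inverse y - inverse x = - (inverse y * (y - x) * inverse x)"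
  using assms by (simp add: algebra_simps)

lemma mnorm_inverse:
  fixes a :: "'a::{division_ring, mult_normed_ring}"
  assumes "a \<noteq> 0"
  shows "mnorm (inverse a) = inverse (mnorm a)"
proof -
  have "mnorm a * mnorm (inverse a) = 1"
    using assms by (simp flip: mnorm_mult)
  then show ?thesis
    by (metis inverse_unique)
qed

text \<open>
  By \<open>inverse_diff_inverse_division_ring\<close> the inverses of \<open>y\<close> and \<open>l\<close> are at distance
  \<open>|y - l| / (|y| |l|)\<close>.
\<close>

lemma tendsto_inverse_mnorm:
  fixes f :: "'b \<Rightarrow> 'a::{division_ring, mult_normed_ring}"
  assumes "(f \<longlongrightarrow> l) F" "l \<noteq> 0"
  shows "((\<lambda>x. inverse (f x)) \<longlongrightarrow> inverse l) F"
proof -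
  have "((\<lambda>x. inverse (mnorm (f x)) * mnorm (f x - l) * inverse (mnorm l))
      \<longlongrightarrow> inverse (mnorm l) * 0 * inverse (mnorm l)) F"
    using assms
    by (intro tendsto_mult tendsto_inverse tendsto_mnorm tendsto_const
        tendsto_iff_mnorm_diff[THEN iffD1]) (auto simp: mnorm_eq_0_iff)
  moreover have "\<forall>\<^sub>F x in F. f x \<noteq> 0"
    using tendsto_imp_eventually_ne[OF assms] .
  then have "\<forall>\<^sub>F x in F. inverse (mnorm (f x)) * mnorm (f x - l) * inverse (mnorm l)
      = mnorm (inverse (f x) - inverse l)"
    by eventually_elim
      (simp add: inverse_diff_inverse_division_ring assms mnorm_mult mnorm_inverse)
  ultimately show ?thesis
    unfolding tendsto_iff_mnorm_diff by (auto intro: Lim_transform_eventually)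
qed

section \<open>Real scalars\<close>

context complete_normed_base_ring
begin

lemma real_emb_one: "real_emb 1 = 1"
  and real_emb_mult: "real_emb (s * t) = real_emb s * real_emb t"
  using real_hom by (auto simp: unital_ring_hom_def)

lemma real_emb_zero: "real_emb 0 = 0"
  using real_hom unfolding unital_ring_hom_def by (metis add_0 add_cancel_right_right)

lemma real_emb_eq_0_iff: "real_emb t = 0 \<longleftrightarrow> t = 0"
  by (metis mult_zero_left real_emb_mult real_emb_one real_emb_zero right_inverse zero_neq_one)

lemma tendsto_real_emb_zero: "(real_emb \<longlongrightarrow> 0) (at 0)"
proof -
  have "continuous_map euclidean euclidean real_emb"
    using real_embedding homeomorphic_imp_continuous_map continuous_map_in_subtopology
    unfolding embedding_map_def by blast
  then have "continuous_on UNIV real_emb"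
    by simp
  then show ?thesis
    using real_emb_zero unfolding continuous_on_def by (metis UNIV_I)
qed

end

lemma (in banach_ring_algebra) tendsto_smul_zero:
  assumes "(c \<longlongrightarrow> 0) F"
  shows "((\<lambda>t. smul (c t) b) \<longlongrightarrow> 0) F"
proof -
  have "((\<lambda>t. mnorm (c t) * mnorm b) \<longlongrightarrow> 0 * mnorm b) F"
    using tendsto_mnorm[OF assms] by (intro tendsto_mult tendsto_const) simp
  then show ?thesis
    unfolding tendsto_iff_mnorm_diff by (simp add: mnorm_smul)
qed

section \<open>Uniqueness of the derivative\<close>

text \<open>
  A linear map \<open>M\<close> with \<open>M a = o(a)\<close> as \<open>a\<close> tends to \<open>0\<close> vanishes, because
  \<open>|M (t b)| / |t b|\<close> does not depend on the nonzero real \<open>t\<close>. The proof takes \<open>M = L - L'\<close>, which is the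
  difference of the two remainders. As \<open>U\<close> is open, \<open>t b\<close> is an admissible increment for small \<open>t\<close>.
\<close>

lemma has_gateaux_derivative_unique:
  fixes f :: "'a::{mult_normed_ring, complete_space} \<Rightarrow> 'a"
    and real_emb :: "real \<Rightarrow> 'd::{comm_ring_1, ring_char_0, mult_normed_ring, complete_space}"
    and smul :: "'d \<Rightarrow> 'a \<Rightarrow> 'a"
  assumes base: "complete_normed_base_ring rat_emb real_emb"
    and alg: "banach_ring_algebra smul"
    and U: "open U" "x \<in> U"
    and L: "has_gateaux_derivative smul f L U x"
    and L': "has_gateaux_derivative smul f L' U x"
  shows "L = L'"
proof
  interpret complete_normed_base_ring rat_emb real_emb by fact
  interpret banach_ring_algebra smul by fact
  let ?V = "{a. x + a \<in> U}"
  obtain r where r: "\<And>a. x + a \<in> U \<Longrightarrow> f (x + a) - f x = L a + r a"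
      "((\<lambda>a. mnorm (r a) / mnorm a) \<longlongrightarrow> 0) (at 0 within ?V)"
    using L unfolding has_gateaux_derivative_def by blast
  obtain r' where r': "\<And>a. x + a \<in> U \<Longrightarrow> f (x + a) - f x = L' a + r' a"
      "((\<lambda>a. mnorm (r' a) / mnorm a) \<longlongrightarrow> 0) (at 0 within ?V)"
    using L' unfolding has_gateaux_derivative_def by blast
  interpret L: module_hom smul smul L
    using L unfolding has_gateaux_derivative_def by blast
  interpret L': module_hom smul smul L'
    using L' unfolding has_gateaux_derivative_def by blast
  fix b
  show "L b = L' b"
  proof (cases "b = 0")
    case False
    define g where "g t = smul (real_emb t) b" for t
    have g0: "(g \<longlongrightarrow> 0) (at 0)"
      unfolding g_def by (intro tendsto_smul_zero tendsto_real_emb_zero)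
    have mg: "mnorm (g t) = mnorm (real_emb t) * mnorm b" for t
      by (simp add: g_def mnorm_smul)
    have pos: "mnorm (real_emb t) \<noteq> 0" if "t \<noteq> 0" for t
      using that by (simp add: mnorm_eq_0_iff real_emb_eq_0_iff)
    have nz: "\<forall>\<^sub>F t in at (0::real). t \<noteq> 0"
      by (simp add: eventually_at_filter)
    have "((\<lambda>t. x + g t) \<longlongrightarrow> x + 0) (at 0)"
      by (intro tendsto_add tendsto_const g0)
    then have inU: "\<forall>\<^sub>F t in at 0. x + g t \<in> U"
      using U by (simp add: topological_tendstoD)
    have "\<forall>\<^sub>F t in at 0. g t \<noteq> 0"
      using nz by eventually_elim (use False pos mg in \<open>metis mnorm_eq_0_iff mult_eq_0_iff\<close>)
    with inU have "filterlim g (at 0 within ?V) (at 0)"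
      using g0 by (auto simp: filterlim_at elim: eventually_elim2)
    then have "((\<lambda>t. mnorm (r (g t)) / mnorm (g t) + mnorm (r' (g t)) / mnorm (g t)) \<longlongrightarrow> 0 + 0) (at 0)"
      by (intro tendsto_add filterlim_compose[OF r(2)] filterlim_compose[OF r'(2)])
    moreover have "\<forall>\<^sub>F t in at 0. mnorm (L b - L' b) / mnorm b
        \<le> mnorm (r (g t)) / mnorm (g t) + mnorm (r' (g t)) / mnorm (g t)"
      using nz inU
    proof eventually_elim
      case (elim t)
      have "smul (real_emb t) (L b - L' b) = L (g t) - L' (g t)"
        by (simp add: g_def L.scale L'.scale scale_right_diff_distrib)
      also have "\<dots> = r' (g t) - r (g t)"
        using r(1)[OF elim(2)] r'(1)[OF elim(2)] by (simp add: algebra_simps)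
      finally have "mnorm (real_emb t) * mnorm (L b - L' b) \<le> mnorm (r (g t)) + mnorm (r' (g t))"
        by (metis add.commute mnorm_smul mnorm_triangle_diff)
      then have "mnorm (real_emb t) * mnorm (L b - L' b) / mnorm (g t)
          \<le> (mnorm (r (g t)) + mnorm (r' (g t))) / mnorm (g t)"
        by (intro divide_right_mono mnorm_ge_0)
      then show ?case
        using pos[OF elim(1)] by (simp add: mg add_divide_distrib)
    qed
    ultimately have "mnorm (L b - L' b) / mnorm b \<le> 0"
      using tendsto_lowerbound[of _ 0 "at (0::real)"] by simp
    then have "mnorm (L b - L' b) = 0"
      using False mnorm_ge_0[of b] mnorm_ge_0[of "L b - L' b"] mnorm_eq_0_iff[of b]
      by (auto simp: divide_le_0_iff)
    then show ?thesis
      by (simp add: mnorm_eq_0_iff)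
  qed simp
qed

lemma gateaux_derivative_eqI:
  fixes f :: "'a::{mult_normed_ring, complete_space} \<Rightarrow> 'a"
    and real_emb :: "real \<Rightarrow> 'd::{comm_ring_1, ring_char_0, mult_normed_ring, complete_space}"
    and smul :: "'d \<Rightarrow> 'a \<Rightarrow> 'a"
  assumes "complete_normed_base_ring rat_emb real_emb" "banach_ring_algebra smul"
    and "open U" "x \<in> U" "has_gateaux_derivative smul f L U x"
  shows "gateaux_derivative smul f U x = L"
  unfolding gateaux_derivative_def
  using assms has_gateaux_derivative_unique[OF assms(1-4)] by blast

section \<open>The derivative of the inverse\<close>

lemma inverse_remainder:
  fixes x a :: "'a::division_ring"
  assumes "x \<noteq> 0" "x + a \<noteq> 0"
  shows "inverse (x + a) - inverse x + inverse x * a * inverse x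
    = inverse (x + a) * a * inverse x * a * inverse x"
proof -
  have "inverse (x + a) - inverse x + inverse x * a * inverse x
      = - ((inverse (x + a) - inverse x) * a * inverse x)"
    using inverse_diff_inverse_division_ring[OF assms] by (simp add: algebra_simps)
  also have "\<dots> = inverse (x + a) * a * inverse x * a * inverse x"
    unfolding inverse_diff_inverse_division_ring[OF assms] by (simp add: mult.assoc)
  finally show ?thesis .
qed

lemma has_gateaux_derivative_inverse:
  fixes x :: "'a::{division_ring, mult_normed_ring, complete_space}"
  assumes "banach_ring_algebra smul" and x: "x \<noteq> 0"
  shows "has_gateaux_derivative smul inverse (\<lambda>a. - inverse x * a * inverse x) {x. x \<noteq> 0} x"
proof -
  interpret banach_ring_algebra smul by fact
  let ?V = "{a. x + a \<in> {x. x \<noteq> 0}}"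
  define r where "r a = inverse (x + a) - inverse x + inverse x * a * inverse x" for a
  have "module_hom smul smul (\<lambda>a. - inverse x * a * inverse x)"
    by unfold_locales (simp_all add: algebra_simps smul_mult_left smul_mult_right)
  moreover have "continuous_on ?V r"
    unfolding continuous_on_def r_def
    by (auto intro!: tendsto_intros tendsto_inverse_mnorm)
  moreover have "((\<lambda>a. mnorm (r a) / mnorm a) \<longlongrightarrow> 0) (at 0 within ?V)"
  proof (rule Lim_transform_eventually)
    show "((\<lambda>a. mnorm (inverse (x + a)) * mnorm (inverse x) * mnorm a * mnorm (inverse x)) \<longlongrightarrow> 0)
        (at 0 within ?V)"
      by (rule tendsto_eq_intros tendsto_inverse_mnorm refl | simp add: x)+
    show "\<forall>\<^sub>F a in at 0 within ?V.
        mnorm (inverse (x + a)) * mnorm (inverse x) * mnorm a * mnorm (inverse x)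
          = mnorm (r a) / mnorm a"
      by (auto simp: eventually_at_filter r_def inverse_remainder x mnorm_mult mnorm_eq_0_iff)
  qed
  ultimately show ?thesis
    unfolding has_gateaux_derivative_def by (intro conjI exI[of _ r]) (auto simp: r_def)
qed

text \<open>
  Real scalars are central in the algebra, so for \<open>t \<noteq> 0\<close> the factor \<open>t\<close> in
  \<open>(x + t b)\<inverse> - x\<inverse> = - (x + t b)\<inverse> (t b) x\<inverse>\<close> cancels.
\<close>

lemma tendsto_inverse_difference_quotient:
  fixes x :: "'a::{division_ring, mult_normed_ring, complete_space}"
    and real_emb :: "real \<Rightarrow> 'd::{comm_ring_1, ring_char_0, mult_normed_ring, complete_space}"
    and smul :: "'d \<Rightarrow> 'a \<Rightarrow> 'a"
  assumes "complete_normed_base_ring rat_emb real_emb" "banach_ring_algebra smul"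
    and x: "x \<noteq> 0"
  shows "((\<lambda>t. smul (real_emb (inverse t)) (inverse (x + smul (real_emb t) b) - inverse x))
    \<longlongrightarrow> - inverse x * b * inverse x) (at 0)"
proof (rule Lim_transform_eventually)
  interpret complete_normed_base_ring rat_emb real_emb by fact
  interpret banach_ring_algebra smul by fact
  have "((\<lambda>t. x + smul (real_emb t) b) \<longlongrightarrow> x + 0) (at 0)"
    by (intro tendsto_add tendsto_const tendsto_smul_zero tendsto_real_emb_zero)
  then have lim: "((\<lambda>t. x + smul (real_emb t) b) \<longlongrightarrow> x) (at 0)"
    by simp
  show "((\<lambda>t. - inverse (x + smul (real_emb t) b) * b * inverse x) \<longlongrightarrow> - inverse x * b * inverse x) (at 0)"
    by (intro tendsto_mult tendsto_minus tendsto_inverse_mnorm lim x tendsto_const)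
  have "\<forall>\<^sub>F t in at (0::real). t \<noteq> 0"
    by (simp add: eventually_at_filter)
  with tendsto_imp_eventually_ne[OF lim x]
  show "\<forall>\<^sub>F t in at 0. - inverse (x + smul (real_emb t) b) * b * inverse x
      = smul (real_emb (inverse t)) (inverse (x + smul (real_emb t) b) - inverse x)"
  proof eventually_elim
    case (elim t)
    have cancel: "real_emb (inverse t) * real_emb t = 1"
      using elim(2) by (simp add: real_emb_one flip: real_emb_mult)
    show ?case
      unfolding inverse_diff_inverse_division_ring[OF x elim(1)]
      by (simp add: smul_mult_left smul_mult_right cancel)
  qed
qed

theorem theorem4p37:
  fixes rat_emb :: "rat \<Rightarrow> 'd::{comm_ring_1, ring_char_0, mult_normed_ring, complete_space}"
    and real_emb :: "real \<Rightarrow> 'd"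
    and smul :: "'d \<Rightarrow> 'a::{division_ring, mult_normed_ring, complete_space} \<Rightarrow> 'a"
  assumes "complete_normed_base_ring rat_emb real_emb"
    and "banach_ring_algebra smul"
  shows "gateaux_differentiable_on smul inverse {x. x \<noteq> 0} \<and>
    (\<forall>x. x \<noteq> 0 \<longrightarrow>
      gateaux_derivative smul inverse {x. x \<noteq> 0} x = - tensor_map [(inverse x, inverse x)] \<and>
      (\<forall>dx. gateaux_derivative smul inverse {x. x \<noteq> 0} x dx = - inverse x * dx * inverse x) \<and>
      (\<forall>dx. ((\<lambda>t. smul (real_emb (inverse t))
                    (inverse (x + smul (real_emb t) dx) - inverse x))
               \<longlongrightarrow> gateaux_derivative smul inverse {x. x \<noteq> 0} x dx) (at 0)) \<and>
      gateaux_components smul inverse {x. x \<noteq> 0} x [(- inverse x, inverse x)])"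
proof -
  have "open {x::'a. x \<noteq> 0}"
    by (simp add: Collect_neg_eq open_Compl)
  then have deriv: "gateaux_derivative smul inverse {x. x \<noteq> 0} x = (\<lambda>a. - inverse x * a * inverse x)"
    if "x \<noteq> 0" for x
    using that by (intro gateaux_derivative_eqI[OF assms] has_gateaux_derivative_inverse[OF assms(2)]) auto
  have "gateaux_differentiable_on smul inverse {x. x \<noteq> 0}"
    unfolding gateaux_differentiable_on_def
    using has_gateaux_derivative_inverse[OF assms(2)] by blast
  moreover have "gateaux_components smul inverse {x. x \<noteq> 0} x [(- inverse x, inverse x)]"
    if "x \<noteq> 0" for x
    unfolding gateaux_components_def deriv[OF that] tensor_map_def
    using has_gateaux_derivative_inverse[OF assms(2) that] by auto
  ultimately show ?thesis
    using tendsto_inverse_difference_quotient[OF assms]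
    by (simp add: deriv fun_eq_iff tensor_map_def)
qed

end
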